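(* Let $A$ be a nonfree abelian group, let $\kappa$ be the minimal cardinality of a nonfree subgroup of $A$, and let $0\to K\xrightarrow{\subseteq}F\to A\to 0$ be a short exact sequence with $F,K$ free and $K\subseteq F$. Then there is a continuous map $\varphi:2^\kappa\to\mathrm{Hom}(K,\mathbb{Z})$ which cannot be lifted pointwise to a continuous map $\psi:2^\kappa\to\mathrm{Hom}(F,\mathbb{Z})$, i.e. there is no continuous $\psi$ with $\psi(f)\restriction K=\varphi(f)$ for all $f\in 2^\kappa$. Moreover, given a basis $B_K$ of $K$, $\varphi$ can be chosen so that $\varphi(f)(t)\in\{0,1\}$ for all $f\in 2^\kappa$ and $t\in B_K$.
   Context: $2^\kappa$ is the space of functions $\kappa\to\{0,1\}$ with the product topology. For discrete abelian groups $G$, $\mathrm{Hom}(G,\mathbb{Z})$ carries the compact-open topology, which is the subspace topology from the product $\mathbb{Z}^G$ ($\mathbb{Z}$ discrete). *)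

theory Defs
  imports
    "HOL-Algebra.Algebra"
    "HOL-Algebra.Free_Abelian_Groups"
    "HOL-Analysis.Function_Topology"
begin

unbundle cardinal_syntax

text \<open>Abelian groups are the multiplicatively written \<^locale>\<open>comm_group\<close>s of the library. An
  element \<open>c\<close> of \<^term>\<open>free_Abelian_group B\<close> is a finitely supported family of integer
  coefficients on \<open>B\<close>; the linear combination it denotes in \<open>G\<close> is the product of the powers
  \<open>b [^] c b\<close> over its support.\<close>

definition int_comb :: "('a, 'm) monoid_scheme \<Rightarrow> ('a \<Rightarrow>\<^sub>0 int) \<Rightarrow> 'a" where
  "int_comb G c = finprod G (\<lambda>b. b [^]\<^bsub>G\<^esub> Poly_Mapping.lookup c b) (Poly_Mapping.keys c)"

definition abelian_basis :: "('a, 'm) monoid_scheme \<Rightarrow> 'a set \<Rightarrow> bool" where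
  "abelian_basis G B \<longleftrightarrow>
     B \<subseteq> carrier G \<and> generate G B = carrier G \<and>
     (\<forall>c \<in> carrier (free_Abelian_group B). int_comb G c = \<one>\<^bsub>G\<^esub> \<longrightarrow> c = 0)"

definition free_abelian :: "('a, 'm) monoid_scheme \<Rightarrow> bool" where
  "free_abelian G \<longleftrightarrow> comm_group G \<and> (\<exists>B. abelian_basis G B)"

definition nonfree_subgroup :: "'a set \<Rightarrow> ('a, 'm) monoid_scheme \<Rightarrow> bool" where
  "nonfree_subgroup H A \<longleftrightarrow> subgroup H A \<and> \<not> free_abelian (A\<lparr>carrier := H\<rparr>)"

definition min_nonfree_card :: "('a, 'm) monoid_scheme \<Rightarrow> 'k rel \<Rightarrow> bool" where
  "min_nonfree_card A \<kappa> \<longleftrightarrow>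
     Card_order \<kappa> \<and> (\<exists>H. nonfree_subgroup H A \<and> |H| =o \<kappa>) \<and>
     (\<forall>H. nonfree_subgroup H A \<longrightarrow> \<kappa> \<le>o |H| )"

text \<open>The space \<open>2\<^sup>\<kappa>\<close>; the underlying set of the cardinal \<open>\<kappa>\<close> is \<^term>\<open>Field \<kappa>\<close>.\<close>

definition cantor_cube :: "'k rel \<Rightarrow> ('k \<Rightarrow> nat) topology" where
  "cantor_cube \<kappa> = product_topology (\<lambda>_. discrete_topology {0, 1}) (Field \<kappa>)"

text \<open>The group of homomorphisms to the integers, with the topology inherited from the product of
  copies of the discrete integers indexed by \<open>G\<close>; for discrete \<open>G\<close> this is the compact-open
  topology. Its points are the homomorphisms that are \<^const>\<open>undefined\<close> outside \<open>carrier G\<close>.\<close>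

definition int_dual :: "('a, 'm) monoid_scheme \<Rightarrow> ('a \<Rightarrow> int) topology" where
  "int_dual G =
     subtopology (product_topology (\<lambda>_. discrete_topology UNIV) (carrier G)) (hom G integer_group)"

lemma topspace_cantor_cube: "topspace (cantor_cube \<kappa>) = Field \<kappa> \<rightarrow>\<^sub>E {0, 1}"
  by (simp add: cantor_cube_def)

lemma topspace_int_dual: "topspace (int_dual G) = hom G integer_group \<inter> extensional (carrier G)"
  by (auto simp: int_dual_def PiE_def)

definition has_continuous_lift ::
  "('b, 'n) monoid_scheme \<Rightarrow> 'b set \<Rightarrow> 'k rel \<Rightarrow> (('k \<Rightarrow> nat) \<Rightarrow> 'b \<Rightarrow> int) \<Rightarrow> bool" where
  "has_continuous_lift F K \<kappa> \<phi> \<longleftrightarrow>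
     (\<exists>\<psi>. continuous_map (cantor_cube \<kappa>) (int_dual F) \<psi> \<and>
          (\<forall>f \<in> topspace (cantor_cube \<kappa>). restrict (\<psi> f) K = \<phi> f))"

context comm_group
begin

lemma int_comb_superset:
  assumes "Poly_Mapping.keys c \<subseteq> S" "finite S" "S \<subseteq> carrier G"
  shows "int_comb G c = finprod G (\<lambda>b. b [^] Poly_Mapping.lookup c b) S"
  unfolding int_comb_def using assms
  by (intro finprod_mono_neutral_cong_left) (auto simp: in_keys_iff)

lemma int_comb_hom:
  assumes B: "B \<subseteq> carrier G"
  shows "int_comb G \<in> hom (free_Abelian_group B) G"
proof (rule homI)
  fix c assume "c \<in> carrier (free_Abelian_group B)"
  then show "int_comb G c \<in> carrier G"
    unfolding int_comb_def using B by (intro finprod_closed) auto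
next
  fix c d assume "c \<in> carrier (free_Abelian_group B)" "d \<in> carrier (free_Abelian_group B)"
  then have k: "Poly_Mapping.keys c \<subseteq> B" "Poly_Mapping.keys d \<subseteq> B" by auto
  let ?S = "Poly_Mapping.keys c \<union> Poly_Mapping.keys d"
  have S: "finite ?S" "?S \<subseteq> carrier G" using k B by auto
  have "int_comb G (c + d) = finprod G (\<lambda>b. b [^] Poly_Mapping.lookup (c + d) b) ?S"
    using S by (intro int_comb_superset keys_add)
  also have "\<dots> = finprod G (\<lambda>b. b [^] Poly_Mapping.lookup c b \<otimes> b [^] Poly_Mapping.lookup d b) ?S"
    using S by (intro finprod_cong') (auto simp: Poly_Mapping.lookup_add int_pow_mult)
  also have "\<dots> = int_comb G c \<otimes> int_comb G d"
    using S int_comb_superset[of c ?S] int_comb_superset[of d ?S]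
    by (subst finprod_multf) auto
  finally show "int_comb G (c \<otimes>\<^bsub>free_Abelian_group B\<^esub> d) = int_comb G c \<otimes> int_comb G d"
    by simp
qed

lemma int_comb_frag_of: "b \<in> carrier G \<Longrightarrow> int_comb G (frag_of b) = b"
  by (simp add: int_comb_def)

lemma int_comb_image:
  assumes B: "B \<subseteq> carrier G"
  shows "int_comb G ` carrier (free_Abelian_group B) = generate G B" (is "?I = _")
proof
  interpret h: group_hom "free_Abelian_group B" G "int_comb G"
    using int_comb_hom[OF B] by (simp add: group_hom_def group_hom_axioms_def is_group)
  have "subgroup ?I G" by (rule h.img_is_subgroup)
  moreover have "B \<subseteq> ?I"
  proof
    fix b assume "b \<in> B"
    then show "b \<in> ?I"
      using B int_comb_frag_of[of b] by (intro image_eqI[of _ _ "frag_of b"]) auto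
  qed
  ultimately show "generate G B \<subseteq> ?I" by (simp add: generate_subgroup_incl)
  have sub: "subgroup (generate G B) G" using B by (rule generate_is_subgroup)
  show "?I \<subseteq> generate G B"
  proof safe
    fix c assume "c \<in> carrier (free_Abelian_group B)"
    then have "Poly_Mapping.keys c \<subseteq> B" by simp
    then show "int_comb G c \<in> generate G B"
    proof (induction rule: free_Abelian_group_induct[consumes 1, case_names zero diff gen])
      case zero
      then show ?case using sub by (simp add: int_comb_def subgroup.one_closed)
    next
      case (diff x y)
      have x: "x \<in> carrier (free_Abelian_group B)" and y: "y \<in> carrier (free_Abelian_group B)"
        using diff by auto
      have "x - y = x \<otimes>\<^bsub>free_Abelian_group B\<^esub> inv\<^bsub>free_Abelian_group B\<^esub> y"
        using diff by simp
      then have "int_comb G (x - y) = int_comb G x \<otimes> inv int_comb G y"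
        using h.hom_mult[OF x h.G.inv_closed[OF y]] h.hom_inv[OF y] by (simp only:)
      then show ?case
        using diff sub by (simp add: subgroup.m_closed subgroup.m_inv_closed)
    next
      case (gen a)
      then have "int_comb G (frag_of a) = a" using B by (intro int_comb_frag_of) auto
      then show ?case using gen by (simp add: generate.incl)
    qed
  qed
qed

text \<open>A basis is a set along which \<open>G\<close> is canonically isomorphic to the library's free abelian
  group.\<close>

lemma abelian_basis_iff_iso:
  "abelian_basis G B \<longleftrightarrow>
     B \<subseteq> carrier G \<and> int_comb G \<in> iso (free_Abelian_group B) G"
proof (cases "B \<subseteq> carrier G")
  case True
  interpret h: group_hom "free_Abelian_group B" G "int_comb G"
    using int_comb_hom[OF True] by (simp add: group_hom_def group_hom_axioms_def is_group)
  show ?thesis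
    using True int_comb_image[OF True] h.iso_iff generate_incl[OF True]
    by (auto simp: abelian_basis_def)
qed (simp add: abelian_basis_def)

end

end

theory Submission
  imports Defs "HOL-Analysis.Product_Topology"
begin

text \<open>Let \<open>H\<close> be a nonfree subgroup of \<open>A\<close> of size \<open>\<kappa>\<close>, choose preimages \<open>s h \<in> F\<close> of the elements of
  \<open>H\<close>, and let \<open>B'\<close> be the set of basis elements of \<open>K\<close> that occur in the cocycle
  \<open>s h + s h' - s (h + h')\<close>. If the coordinate functions of \<open>K\<close> at all \<open>b \<in> B'\<close> extend to
  homomorphisms \<open>g b\<close> on \<open>F\<close> with only finitely many \<open>g b x\<close> nonzero for each \<open>x\<close>, then
  \<open>h \<mapsto> s h - \<Sum>\<^sub>b g b (s h) \<cdot> b\<close> embeds \<open>H\<close> in the free group \<open>F\<close>, which is impossible.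
  For infinite \<open>\<kappa>\<close>, embed \<open>B'\<close> in \<open>\<kappa>\<close> and let \<open>\<phi> f\<close> be the homomorphism that takes the value
  \<open>f b\<close> at \<open>b \<in> B'\<close> and \<open>0\<close> on the rest of the basis. A continuous lift \<open>\<psi>\<close> would yield such
  extensions \<open>\<psi> 1\<^sub>b - \<psi> 0\<close>, where \<open>1\<^sub>b\<close> is the characteristic function of \<open>b\<close>.
  For finite \<open>\<kappa>\<close> the set \<open>B'\<close> is finite, so some coordinate function does not extend at all, and
  it serves as a constant \<open>\<phi>\<close>.\<close>

section \<open>Subgroups of free abelian groups\<close>

lemma (in comm_group) subgroup_imp_comm_group:
  assumes "subgroup H G" shows "comm_group (G\<lparr>carrier := H\<rparr>)"
  using assms subgroup.mem_carrier[OF assms]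
  by (intro group.group_comm_groupI[OF subgroup.subgroup_is_group])
     (auto simp: m_comm)

text \<open>Turns a relation in \<open>G\<close> into one integer equation for each position
  \<open>x\<close>, so that independence can be tested at a single well-chosen position.\<close>

lemma lookup_hom_int_comb:
  assumes G: "comm_group G" and \<tau>: "\<tau> \<in> hom G (free_Abelian_group Y)"
    and c: "Poly_Mapping.keys c \<subseteq> carrier G"
  shows "Poly_Mapping.lookup (\<tau> (int_comb G c)) x =
    (\<Sum>b\<in>Poly_Mapping.keys c. Poly_Mapping.lookup c b * Poly_Mapping.lookup (\<tau> b) x)"
proof -
  interpret comm_group G by fact
  interpret h: group_hom G "free_Abelian_group Y" \<tau>
    using \<tau> by (simp add: group_hom_def group_hom_axioms_def is_group)
  have "Poly_Mapping.lookup (\<tau> (finprod G (\<lambda>b. b [^]\<^bsub>G\<^esub> Poly_Mapping.lookup c b) S)) x =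
      (\<Sum>b\<in>S. Poly_Mapping.lookup c b * Poly_Mapping.lookup (\<tau> b) x)"
    if "finite S" "S \<subseteq> carrier G" for S
    using that
  proof (induction S rule: finite_induct)
    case empty
    then show ?case using h.hom_one by simp
  next
    case (insert a S)
    have a: "a \<in> carrier G" using insert by simp
    have ka: "Poly_Mapping.keys (\<tau> a) \<subseteq> Y" using h.hom_closed[OF a] by simp
    have "(\<lambda>b. b [^]\<^bsub>G\<^esub> Poly_Mapping.lookup c b) \<in> S \<rightarrow> carrier G" using insert.prems by auto
    then show ?case using insert a ka by (simp add: h.hom_int_pow Poly_Mapping.lookup_add)
  qed
  from this[OF finite_keys c] show ?thesis by (simp add: int_comb_def)
qed

text \<open>The classical proof that subgroups of free abelian groups are free: well-order \<open>Y\<close> and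
  choose, for every leading position occurring in the image, an element whose leading
  coefficient there is minimal in absolute value.\<close>

lemma free_abelian_if_embeds:
  fixes H :: "('a, 'm) monoid_scheme" and Y :: "'x set"
  assumes H: "comm_group H" and \<tau>: "\<tau> \<in> hom H (free_Abelian_group Y)"
    and inj: "inj_on \<tau> (carrier H)"
  shows "free_abelian H"
proof -
  interpret comm_group H by fact
  interpret h: group_hom H "free_Abelian_group Y" \<tau>
    using \<tau> by (simp add: group_hom_def group_hom_axioms_def is_group)
  obtain r where r: "well_order_on UNIV (r :: 'x rel)" using well_order_on by blast
  have r_trans: "(x, z) \<in> r" if "(x, y) \<in> r" "(y, z) \<in> r" for x y z
    using r that unfolding order_on_defs by (meson transD)
  have r_antisym: "x = y" if "(x, y) \<in> r" "(y, x) \<in> r" for x y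
    using r that unfolding order_on_defs by (meson antisymD)
  have r_refl: "(x, x) \<in> r" for x
    using r unfolding order_on_defs by (simp add: refl_on_def)
  have r_total: "(x, y) \<in> r \<or> (y, x) \<in> r" for x y
    using r r_refl[of x] unfolding order_on_defs by (cases "x = y") (simp_all add: total_on_def)
  have r_wf: "wf (r - Id)"
    using r by (simp add: well_order_on_def)
  define lead where "lead c x \<longleftrightarrow> x \<in> Poly_Mapping.keys c \<and> (\<forall>y\<in>Poly_Mapping.keys c. (y, x) \<in> r)"
    for c :: "'x \<Rightarrow>\<^sub>0 int" and x
  \<comment> \<open>The key function \<open>f\<close> allows two uses: with the identity for leading
    positions, and with \<open>v\<close> below for the generator of highest leading position in a
    relation.\<close>
  have max: "\<exists>x\<in>S. \<forall>y\<in>S. (f y, f x) \<in> r" if "finite S" "S \<noteq> {}" for f :: "'z \<Rightarrow> 'x" and S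
    using that
  proof (induction rule: finite_ne_induct)
    case (singleton a)
    then show ?case using r_refl by simp
  next
    case (insert a S)
    then obtain x where x: "x \<in> S" "\<forall>y\<in>S. (f y, f x) \<in> r" by blast
    show ?case
    proof (cases "(f a, f x) \<in> r")
      case True
      then show ?thesis using x by (intro bexI[of _ x]) auto
    next
      case False
      then have "(f x, f a) \<in> r" using r_total by blast
      then show ?thesis using x r_refl[of "f a"] by (intro bexI[of _ a]) (auto intro: r_trans)
    qed
  qed
  have ex_lead: "\<exists>x. lead c x" if "c \<noteq> 0" for c
    using max[of "Poly_Mapping.keys c" "\<lambda>x. x"] that by (auto simp: lead_def)
  let ?co = "\<lambda>h x. nat \<bar>Poly_Mapping.lookup (\<tau> h) x\<bar>"
  define S where "S = {x. \<exists>h\<in>carrier H. lead (\<tau> h) x}"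
  define P where "P x h \<longleftrightarrow> h \<in> carrier H \<and> lead (\<tau> h) x" for x h
  define u where "u x = arg_min (\<lambda>h. ?co h x) (P x)" for x
  have u_P: "P x (u x)" and u_le: "\<And>h. P x h \<Longrightarrow> ?co (u x) x \<le> ?co h x" if x: "x \<in> S" for x
  proof -
    obtain h where h: "P x h" using x by (auto simp: S_def P_def)
    show "P x (u x)" using arg_min_natI[where P = "P x", OF h] by (simp add: u_def)
    show "?co (u x) x \<le> ?co h x" if "P x h" for h
      using arg_min_nat_le[where P = "P x", OF that] by (simp add: u_def)
  qed
  then have u: "u x \<in> carrier H" "lead (\<tau> (u x)) x" if "x \<in> S" for x
    using that by (auto simp: P_def)
  have u_min: "?co (u x) x \<le> ?co h x" if "x \<in> S" "h \<in> carrier H" "lead (\<tau> h) x" for x h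
    using u_le that by (simp add: P_def)
  have u_carr: "u ` S \<subseteq> carrier H" using u by auto
  have indep: "c = 0" if c: "Poly_Mapping.keys c \<subseteq> u ` S" and 1: "int_comb H c = \<one>\<^bsub>H\<^esub>" for c
  proof (rule ccontr)
    assume "c \<noteq> 0"
    \<comment> \<open>\<open>v\<close> recovers the leading position from a generator. In a
      relation, the generator \<open>b\<close> with the largest \<open>v b\<close> is the only one
      whose image has a nonzero coefficient at \<open>v b\<close>, so its own coefficient must
      vanish.\<close>
    define v where "v = inv_into S u"
    have v: "v b \<in> S" "u (v b) = b" if "b \<in> Poly_Mapping.keys c" for b
      using that c by (auto simp: v_def inv_into_into f_inv_into_f subset_iff)
    obtain b where b: "b \<in> Poly_Mapping.keys c" and
      bmax: "\<And>b'. b' \<in> Poly_Mapping.keys c \<Longrightarrow> (v b', v b) \<in> r"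
      using max[of "Poly_Mapping.keys c" v] \<open>c \<noteq> 0\<close> by auto
    have other: "Poly_Mapping.lookup (\<tau> b') (v b) = 0"
      if "b' \<in> Poly_Mapping.keys c" "b' \<noteq> b" for b'
    proof (rule ccontr)
      assume "Poly_Mapping.lookup (\<tau> b') (v b) \<noteq> 0"
      then have "v b \<in> Poly_Mapping.keys (\<tau> b')" by (simp add: in_keys_iff)
      moreover have "lead (\<tau> b') (v b')" using u(2)[OF v(1)] v(2) that by metis
      ultimately have "(v b, v b') \<in> r" by (simp add: lead_def)
      then have "v b = v b'" using bmax[OF that(1)] r_antisym by blast
      then show False using v(2) b that by metis
    qed
    have "0 = (\<Sum>b'\<in>Poly_Mapping.keys c. Poly_Mapping.lookup c b' * Poly_Mapping.lookup (\<tau> b') (v b))"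
      using lookup_hom_int_comb[OF H \<tau>, of c "v b"] c u_carr 1 h.hom_one by auto
    also have "\<dots> = Poly_Mapping.lookup c b * Poly_Mapping.lookup (\<tau> b) (v b)"
      using other b by (subst sum.remove[of _ b]) auto
    finally have "Poly_Mapping.lookup (\<tau> b) (v b) = 0" using b by (simp add: in_keys_iff)
    moreover have "lead (\<tau> b) (v b)" using u(2)[OF v(1)] v(2) b by metis
    ultimately show False by (simp add: lead_def in_keys_iff)
  qed
  have gen_sub: "subgroup (generate H (u ` S)) H" using u_carr by (rule generate_is_subgroup)
  have zero: "h \<in> generate H (u ` S)" if "h \<in> carrier H" "\<tau> h = 0" for h
  proof -
    have "h = \<one>\<^bsub>H\<^esub>" using inj_onD[OF inj, of h "\<one>\<^bsub>H\<^esub>"] that h.hom_one by simp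
    then show ?thesis using gen_sub by (simp add: subgroup.one_closed)
  qed
  \<comment> \<open>Well-founded induction on the leading position, with division with remainder as
    the reduction step.\<close>
  have span: "\<forall>h\<in>carrier H. lead (\<tau> h) x \<longrightarrow> h \<in> generate H (u ` S)" for x
  proof (induction x rule: wf_induct_rule[OF r_wf])
    case (1 x)
    show ?case
    proof (intro ballI impI)
      fix h assume h: "h \<in> carrier H" "lead (\<tau> h) x"
      then have x: "x \<in> S" unfolding S_def by blast
      define n where "n = Poly_Mapping.lookup (\<tau> (u x)) x"
      define q where "q = Poly_Mapping.lookup (\<tau> h) x div n"
      define k where "k = h \<otimes>\<^bsub>H\<^esub> inv\<^bsub>H\<^esub> (u x [^]\<^bsub>H\<^esub> q)"
      have ux: "u x \<in> carrier H" "lead (\<tau> (u x)) x" using u x by auto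
      have n: "n \<noteq> 0" using ux by (auto simp: n_def lead_def in_keys_iff)
      have k: "k \<in> carrier H" using h ux by (simp add: k_def)
      have "Poly_Mapping.keys (\<tau> (u x)) \<subseteq> Y" using h.hom_closed[OF ux(1)] by simp
      moreover have "Poly_Mapping.keys (frag_cmul q (\<tau> (u x))) \<subseteq> Y"
        using calculation keys_cmul by blast
      ultimately have tk: "\<tau> k = \<tau> h - frag_cmul q (\<tau> (u x))"
        using h ux by (simp add: k_def h.hom_int_pow)
      have le: "(y, x) \<in> r" if "y \<in> Poly_Mapping.keys (\<tau> k)" for y
      proof -
        have "y \<in> Poly_Mapping.keys (\<tau> h) \<union> Poly_Mapping.keys (\<tau> (u x))"
          using that keys_diff[of "\<tau> h" "frag_cmul q (\<tau> (u x))"] keys_cmul[of q "\<tau> (u x)"]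
          unfolding tk by blast
        then show ?thesis using h(2) ux(2) by (auto simp: lead_def)
      qed
      have kx: "Poly_Mapping.lookup (\<tau> k) x = Poly_Mapping.lookup (\<tau> h) x mod n"
        by (simp add: tk lookup_minus n_def q_def minus_div_mult_eq_mod)
      \<comment> \<open>The coefficient of \<open>\<tau> k\<close> at \<open>x\<close> is a
        remainder modulo \<open>n\<close>, smaller than \<open>n\<close> in absolute value. If it
        were nonzero, \<open>k\<close> would contradict the minimal choice of \<open>u x\<close>.
        Hence \<open>k\<close> is zero or leads strictly below \<open>x\<close>.\<close>
      have notin: "x \<notin> Poly_Mapping.keys (\<tau> k)"
      proof
        assume "x \<in> Poly_Mapping.keys (\<tau> k)"
        then have "lead (\<tau> k) x" using le by (auto simp: lead_def)
        from u_min[OF x k this] have "\<bar>n\<bar> \<le> \<bar>Poly_Mapping.lookup (\<tau> h) x mod n\<bar>"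
          unfolding kx by (simp flip: n_def)
        then show False using abs_mod_less[OF n, of "Poly_Mapping.lookup (\<tau> h) x"] by linarith
      qed
      have "k \<in> generate H (u ` S)"
      proof (cases "\<tau> k = 0")
        case False
        then obtain y where y: "lead (\<tau> k) y" using ex_lead by blast
        then have "(y, x) \<in> r - Id" using notin le by (auto simp: lead_def)
        then show ?thesis using 1 k y by blast
      qed (use zero k in auto)
      moreover have "u x \<in> generate H (u ` S)" using x by (simp add: generate.incl)
      moreover have "h = k \<otimes>\<^bsub>H\<^esub> u x [^]\<^bsub>H\<^esub> q"
        using h ux by (simp add: k_def m_assoc)
      ultimately show "h \<in> generate H (u ` S)"
        using gen_sub by (simp add: subgroup.m_closed subgroup_int_pow_closed)
    qed
  qed
  have "generate H (u ` S) = carrier H"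
    using generate_incl[OF u_carr] span zero ex_lead by blast
  then show ?thesis
    unfolding free_abelian_def abelian_basis_def using H u_carr indep by auto
qed

section \<open>Coordinates with respect to a basis\<close>

text \<open>For a basis \<open>B\<close> this inverts the canonical isomorphism; the inverse is
  taken on the carrier because \<open>int_comb G\<close> is bijective only there.\<close>

definition basis_coords :: "('a, 'm) monoid_scheme \<Rightarrow> 'a set \<Rightarrow> 'a \<Rightarrow> 'a \<Rightarrow>\<^sub>0 int" where
  "basis_coords G B = inv_into (carrier (free_Abelian_group B)) (int_comb G)"

context
  fixes G :: "('a, 'm) monoid_scheme" and B
  assumes G: "comm_group G" and B: "abelian_basis G B"
begin

lemma basis_coords_iso: "basis_coords G B \<in> iso G (free_Abelian_group B)"
  unfolding basis_coords_def
  using B comm_group.abelian_basis_iff_iso[OF G]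
  by (intro group.iso_set_sym[OF group_free_Abelian_group]) auto

lemma basis_coords_hom: "basis_coords G B \<in> hom G (free_Abelian_group B)"
  using basis_coords_iso by (simp add: iso_def)

lemma basis_coords_inj: "inj_on (basis_coords G B) (carrier G)"
  using basis_coords_iso by (simp add: iso_def bij_betw_def)

lemma keys_basis_coords: "x \<in> carrier G \<Longrightarrow> Poly_Mapping.keys (basis_coords G B x) \<subseteq> B"
  using hom_in_carrier[OF basis_coords_hom] by fastforce

lemma basis_coords_mult:
  "x \<in> carrier G \<Longrightarrow> y \<in> carrier G \<Longrightarrow>
    basis_coords G B (x \<otimes>\<^bsub>G\<^esub> y) = basis_coords G B x + basis_coords G B y"
  using hom_mult[OF basis_coords_hom] by simp

lemma int_comb_basis_coords: "x \<in> carrier G \<Longrightarrow> int_comb G (basis_coords G B x) = x"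
  using B comm_group.abelian_basis_iff_iso[OF G, of B] unfolding basis_coords_def
  by (intro f_inv_into_f) (auto simp: iso_def bij_betw_def)

lemma basis_coords_basis:
  assumes "b \<in> B" shows "basis_coords G B b = frag_of b"
proof -
  have "b \<in> carrier G" "inj_on (int_comb G) (carrier (free_Abelian_group B))"
    using B assms comm_group.abelian_basis_iff_iso[OF G, of B] by (auto simp: iso_def bij_betw_def)
  moreover have "frag_of b \<in> carrier (free_Abelian_group B)" using assms by simp
  ultimately show ?thesis
    using inv_into_f_f[of "int_comb G" "carrier (free_Abelian_group B)" "frag_of b"]
      comm_group.int_comb_frag_of[OF G] unfolding basis_coords_def by metis
qed

end

section \<open>Continuity on the cube and into the dual\<close>

text \<open>The map \<open>w\<close> is constant on a basic neighbourhood of the zero function. Such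
  a neighbourhood constrains only finitely many coordinates, and switching any other coordinate to 1
  stays inside it.\<close>

lemma finite_changes_at_zero:
  assumes w: "continuous_map (cantor_cube \<kappa>) (discrete_topology UNIV) w"
  shows "finite {i \<in> Field \<kappa>. w (\<lambda>j\<in>Field \<kappa>. if j = i then 1 else 0) \<noteq> w (\<lambda>j\<in>Field \<kappa>. 0)}"
proof -
  let ?z = "\<lambda>j\<in>Field \<kappa>. 0::nat"
  have z: "?z \<in> topspace (cantor_cube \<kappa>)" by (auto simp: topspace_cantor_cube)
  define S where "S = {f \<in> topspace (cantor_cube \<kappa>). w f \<in> {w ?z}}"
  have "openin (cantor_cube \<kappa>) S"
    unfolding S_def using w by (rule openin_continuous_map_preimage) simp
  moreover have "?z \<in> S" using z by (simp add: S_def)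
  ultimately obtain V where V: "finite {i \<in> Field \<kappa>. V i \<noteq> {0, 1}}" "?z \<in> Pi\<^sub>E (Field \<kappa>) V"
    "Pi\<^sub>E (Field \<kappa>) V \<subseteq> S"
    unfolding cantor_cube_def openin_product_topology_alt topspace_discrete_topology by blast
  have "w (\<lambda>j\<in>Field \<kappa>. if j = i then 1 else 0) = w ?z"
    if i: "i \<in> Field \<kappa>" "V i = {0, 1}" for i
  proof -
    have "(if j = i then 1 else 0) \<in> V j" if j: "j \<in> Field \<kappa>" for j
      using PiE_mem[OF V(2) j] i j by auto
    then have "(\<lambda>j\<in>Field \<kappa>. if j = i then 1 else 0) \<in> Pi\<^sub>E (Field \<kappa>) V"
      by (intro restrict_PiE_iff[THEN iffD2] ballI)
    then have "(\<lambda>j\<in>Field \<kappa>. if j = i then 1 else 0) \<in> S" using V(3) by (rule rev_subsetD)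
    then show ?thesis unfolding S_def by blast
  qed
  then show ?thesis by (intro finite_subset[OF _ V(1)]) auto
qed

text \<open>The product of two discrete spaces is discrete, so addition is continuous on it.\<close>

lemma continuous_map_discrete_add:
  assumes "continuous_map U (discrete_topology UNIV) f" "continuous_map U (discrete_topology UNIV) g"
  shows "continuous_map U (discrete_topology UNIV) (\<lambda>x. f x + g x)"
proof -
  have "continuous_map U (discrete_topology UNIV) (\<lambda>x. (f x, g x))"
    using continuous_map_pairedI[OF assms] by (simp flip: prod_topology_discrete_topology)
  then have "continuous_map U (discrete_topology UNIV) ((\<lambda>(a, b). a + b) \<circ> (\<lambda>x. (f x, g x)))"
    by (rule continuous_map_compose) simp
  then show ?thesis by (simp add: o_def)
qed

lemma continuous_map_discrete_sum:
  assumes "\<And>i. i \<in> I \<Longrightarrow> continuous_map U (discrete_topology UNIV) (f i)"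
  shows "continuous_map U (discrete_topology UNIV) (\<lambda>x. \<Sum>i\<in>I. f i x :: 'b :: comm_monoid_add)"
  using assms
  by (induction I rule: infinite_finite_induct) (auto intro: continuous_map_discrete_add)

text \<open>The dual is a subspace of a product, so continuity is decided by the evaluations at
  single elements.\<close>

lemma continuous_map_into_int_dual:
  assumes "\<And>f. f \<in> topspace U \<Longrightarrow> \<phi> f \<in> hom G integer_group \<inter> extensional (carrier G)"
    and "\<And>x. x \<in> carrier G \<Longrightarrow> continuous_map U (discrete_topology UNIV) (\<lambda>f. \<phi> f x)"
  shows "continuous_map U (int_dual G) \<phi>"
  unfolding int_dual_def continuous_map_in_subtopology continuous_map_componentwise
  using assms by auto

lemma continuous_map_int_dual_eval:
  assumes "continuous_map U (int_dual G) \<psi>" "x \<in> carrier G"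
  shows "continuous_map U (discrete_topology UNIV) (\<lambda>f. \<psi> f x)"
  using assms unfolding int_dual_def continuous_map_in_subtopology continuous_map_componentwise
  by blast

section \<open>Splitting the presentation over a subgroup\<close>

text \<open>The exact sequence is encoded by the surjection \<open>p\<close> with kernel
  \<open>K\<close>.\<close>

locale free_presentation =
  fixes A :: "('a, 'm) monoid_scheme" and F :: "('b, 'n) monoid_scheme"
    and K :: "'b set" and p :: "'b \<Rightarrow> 'a" and B :: "'b set"
  assumes A: "comm_group A" and F: "free_abelian F"
    and K: "subgroup K F" and p: "p \<in> epi F A" and ker: "kernel F A p = K"
    and B: "abelian_basis (F\<lparr>carrier := K\<rparr>) B"
begin

abbreviation coord :: "'b \<Rightarrow> 'b \<Rightarrow>\<^sub>0 int" where
  "coord \<equiv> basis_coords (F\<lparr>carrier := K\<rparr>) B"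

sublocale A: comm_group A by (rule A)
sublocale F: comm_group F using F by (simp add: free_abelian_def)
sublocale p: group_hom F A p
  using p by (simp add: epi_def group_hom_def group_hom_axioms_def A.is_group F.is_group)

lemma K_group: "comm_group (F\<lparr>carrier := K\<rparr>)"
  using K by (rule F.subgroup_imp_comm_group)

lemma K_carrier: "k \<in> K \<Longrightarrow> k \<in> carrier F"
  using K by (rule subgroup.mem_carrier)

lemma B_subset: "B \<subseteq> K"
  using B by (simp add: abelian_basis_def)

lemma mem_K_iff: "k \<in> K \<longleftrightarrow> k \<in> carrier F \<and> p k = \<one>\<^bsub>A\<^esub>"
  using ker by (auto simp: kernel_def)

lemma coord_mult: "k \<in> K \<Longrightarrow> l \<in> K \<Longrightarrow> coord (k \<otimes>\<^bsub>F\<^esub> l) = coord k + coord l"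
  using basis_coords_mult[OF K_group B, of k l] by simp

text \<open>The correction \<open>\<Sum>\<^sub>b g b k \<cdot> b\<close> is \<open>k\<close> itself for every value \<open>k\<close> of the cocycle, which makes
  \<open>h \<mapsto> s h - \<Sum>\<^sub>b g b (s h) \<cdot> b\<close> additive.\<close>

lemma free_abelian_if_splits:
  assumes H: "subgroup H A"
    and s: "\<And>h. h \<in> H \<Longrightarrow> s h \<in> carrier F" "\<And>h. h \<in> H \<Longrightarrow> p (s h) = h"
    and B': "B' \<subseteq> B"
    and cocycle: "\<And>h h'. h \<in> H \<Longrightarrow> h' \<in> H \<Longrightarrow>
      Poly_Mapping.keys (coord (s h \<otimes>\<^bsub>F\<^esub> s h' \<otimes>\<^bsub>F\<^esub> inv\<^bsub>F\<^esub> s (h \<otimes>\<^bsub>A\<^esub> h'))) \<subseteq> B'"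
    and g: "\<And>b. b \<in> B' \<Longrightarrow> g b \<in> hom F integer_group"
    and g_K: "\<And>b k. b \<in> B' \<Longrightarrow> k \<in> K \<Longrightarrow> g b k = Poly_Mapping.lookup (coord k) b"
    and fin: "\<And>x. x \<in> carrier F \<Longrightarrow> finite {b \<in> B'. g b x \<noteq> 0}"
  shows "free_abelian (A\<lparr>carrier := H\<rparr>)"
proof -
  let ?K = "F\<lparr>carrier := K\<rparr>"
  interpret K: comm_group ?K by (rule K_group)
  \<comment> \<open>The values \<open>g b x\<close> serve as coordinates of an element of
    \<open>K\<close>; \<open>fin\<close> makes the support finite, as
    \<open>Abs_poly_mapping\<close> requires.\<close>
  define c where "c x = Abs_poly_mapping (\<lambda>b. if b \<in> B' then g b x else 0)" for x
  have c: "Poly_Mapping.lookup (c x) b = (if b \<in> B' then g b x else 0)" if "x \<in> carrier F" for x b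
  proof -
    have "finite {b. (if b \<in> B' then g b x else 0) \<noteq> 0}"
      using fin[OF that] by (rule rev_finite_subset) (auto split: if_splits)
    then show ?thesis unfolding c_def by (simp add: Abs_poly_mapping_inverse)
  qed
  have c_mult: "c (x \<otimes>\<^bsub>F\<^esub> y) = c x + c y" if "x \<in> carrier F" "y \<in> carrier F" for x y
    using that g by (intro poly_mapping_eqI) (auto simp: c Poly_Mapping.lookup_add hom_def)
  have c_keys: "Poly_Mapping.keys (c x) \<subseteq> B" if "x \<in> carrier F" for x
    using that B' by (auto simp: in_keys_iff c split: if_splits)
  \<comment> \<open>\<open>d\<close> is the correction term: a homomorphism from \<open>F\<close> to
    \<open>K\<close> that fixes every element of \<open>K\<close> whose coordinates are supported in
    \<open>B'\<close>.\<close>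
  define d where "d x = int_comb ?K (c x)" for x
  have hom: "int_comb ?K \<in> hom (free_Abelian_group B) ?K"
    using B_subset by (intro K.int_comb_hom) simp
  have d_K: "d x \<in> K" if "x \<in> carrier F" for x
    unfolding d_def using hom_in_carrier[OF hom] c_keys[OF that] by simp
  have d_mult: "d (x \<otimes>\<^bsub>F\<^esub> y) = d x \<otimes>\<^bsub>F\<^esub> d y" if "x \<in> carrier F" "y \<in> carrier F" for x y
    unfolding d_def c_mult[OF that] using hom_mult[OF hom, of "c x" "c y"] c_keys that by simp
  have d_id: "d k = k" if "k \<in> K" "Poly_Mapping.keys (coord k) \<subseteq> B'" for k
  proof -
    have "c k = coord k"
      using that K_carrier by (intro poly_mapping_eqI) (auto simp: c g_K in_keys_iff)
    then show ?thesis using int_comb_basis_coords[OF K_group B, of k] that by (simp add: d_def)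
  qed
  define \<sigma> where "\<sigma> h = s h \<otimes>\<^bsub>F\<^esub> inv\<^bsub>F\<^esub> d (s h)" for h
  have H_A: "h \<in> carrier A" if "h \<in> H" for h using H that by (rule subgroup.mem_carrier)
  have \<sigma>_F: "\<sigma> h \<in> carrier F" if "h \<in> H" for h
    using that s d_K K_carrier by (simp add: \<sigma>_def)
  \<comment> \<open>The correction lies in the kernel of \<open>p\<close>, so
    \<open>\<sigma>\<close> is still a section.\<close>
  have p_\<sigma>: "p (\<sigma> h) = h" if "h \<in> H" for h
    using that s d_K[of "s h"] H_A by (simp add: \<sigma>_def mem_K_iff)
  have "\<sigma> (h \<otimes>\<^bsub>A\<^esub> h') = \<sigma> h \<otimes>\<^bsub>F\<^esub> \<sigma> h'" if h: "h \<in> H" "h' \<in> H" for h h'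
  proof -
    have hh: "h \<otimes>\<^bsub>A\<^esub> h' \<in> H" using H h by (rule subgroup.m_closed)
    define x y z where "x = s h" and "y = s h'" and "z = s (h \<otimes>\<^bsub>A\<^esub> h')"
    have xyz: "x \<in> carrier F" "y \<in> carrier F" "z \<in> carrier F"
      using s h hh by (auto simp: x_def y_def z_def)
    define k where "k = x \<otimes>\<^bsub>F\<^esub> y \<otimes>\<^bsub>F\<^esub> inv\<^bsub>F\<^esub> z"
    have k: "k \<in> K"
      using xyz s h hh H_A by (simp add: mem_K_iff k_def) (simp add: x_def y_def z_def)
    have dk: "d k = k" using k cocycle[OF h] by (intro d_id) (auto simp: k_def x_def y_def z_def)
    have xy: "x \<otimes>\<^bsub>F\<^esub> y = k \<otimes>\<^bsub>F\<^esub> z" using xyz by (simp add: k_def F.m_assoc)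
    have dc: "d x \<in> carrier F" "d y \<in> carrier F" "d z \<in> carrier F" "k \<in> carrier F"
      using d_K xyz K_carrier k by auto
    have "d x \<otimes>\<^bsub>F\<^esub> d y = k \<otimes>\<^bsub>F\<^esub> d z"
      using d_mult[of x y] d_mult[of k z] xyz dc dk xy by simp
    then have "(x \<otimes>\<^bsub>F\<^esub> y) \<otimes>\<^bsub>F\<^esub> inv\<^bsub>F\<^esub> (d x \<otimes>\<^bsub>F\<^esub> d y) = (k \<otimes>\<^bsub>F\<^esub> z) \<otimes>\<^bsub>F\<^esub> inv\<^bsub>F\<^esub> (k \<otimes>\<^bsub>F\<^esub> d z)"
      using xy by simp
    also have "\<dots> = (k \<otimes>\<^bsub>F\<^esub> inv\<^bsub>F\<^esub> k) \<otimes>\<^bsub>F\<^esub> (z \<otimes>\<^bsub>F\<^esub> inv\<^bsub>F\<^esub> d z)"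
      using xyz dc by (simp only: F.inv_mult F.m_ac F.m_closed F.inv_closed)
    also have "\<dots> = z \<otimes>\<^bsub>F\<^esub> inv\<^bsub>F\<^esub> d z" using xyz dc by simp
    finally have "z \<otimes>\<^bsub>F\<^esub> inv\<^bsub>F\<^esub> d z = (x \<otimes>\<^bsub>F\<^esub> y) \<otimes>\<^bsub>F\<^esub> inv\<^bsub>F\<^esub> (d x \<otimes>\<^bsub>F\<^esub> d y)" ..
    also have "\<dots> = (x \<otimes>\<^bsub>F\<^esub> inv\<^bsub>F\<^esub> d x) \<otimes>\<^bsub>F\<^esub> (y \<otimes>\<^bsub>F\<^esub> inv\<^bsub>F\<^esub> d y)"
      using xyz dc by (simp only: F.inv_mult F.m_ac F.m_closed F.inv_closed)
    finally show ?thesis by (simp add: \<sigma>_def x_def y_def z_def)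
  qed
  then have \<sigma>_hom: "\<sigma> \<in> hom (A\<lparr>carrier := H\<rparr>) F" using \<sigma>_F by (intro homI) auto
  \<comment> \<open>As a section of \<open>p\<close>, \<open>\<sigma>\<close> is injective. Composed
    with coordinates in \<open>F\<close>, it embeds \<open>H\<close> in a free abelian
    group.\<close>
  obtain Y where Y: "abelian_basis F Y" using F by (auto simp: free_abelian_def)
  have "basis_coords F Y \<circ> \<sigma> \<in> hom (A\<lparr>carrier := H\<rparr>) (free_Abelian_group Y)"
    using \<sigma>_hom basis_coords_hom[OF F.comm_group_axioms Y] by (rule hom_compose)
  moreover have "inj_on \<sigma> H" using p_\<sigma> by (rule inj_on_inverseI)
  then have "inj_on (basis_coords F Y \<circ> \<sigma>) H"
    using \<sigma>_F by (intro comp_inj_on inj_on_subset[OF basis_coords_inj[OF F.comm_group_axioms Y]]) auto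
  ultimately show ?thesis
    using A.subgroup_imp_comm_group[OF H] by (intro free_abelian_if_embeds) auto
qed

definition cube_hom :: "'b set \<Rightarrow> ('b \<Rightarrow> 'k) \<Rightarrow> ('k \<Rightarrow> nat) \<Rightarrow> 'b \<Rightarrow> int" where
  "cube_hom B' j f = (\<lambda>k\<in>K. \<Sum>b\<in>Poly_Mapping.keys (coord k).
     (if b \<in> B' then int (f (j b)) else 0) * Poly_Mapping.lookup (coord k) b)"

lemma cube_hom_hom: "cube_hom B' j f \<in> hom (F\<lparr>carrier := K\<rparr>) integer_group"
proof (rule homI)
  let ?a = "\<lambda>b. if b \<in> B' then int (f (j b)) else 0"
  fix k l assume "k \<in> carrier (F\<lparr>carrier := K\<rparr>)" "l \<in> carrier (F\<lparr>carrier := K\<rparr>)"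
  then have kl: "k \<in> K" "l \<in> K" "k \<otimes>\<^bsub>F\<^esub> l \<in> K" using subgroup.m_closed[OF K] by auto
  let ?S = "Poly_Mapping.keys (coord k) \<union> Poly_Mapping.keys (coord l)"
  have S: "(\<Sum>b\<in>Poly_Mapping.keys c. ?a b * Poly_Mapping.lookup c b) =
      (\<Sum>b\<in>?S. ?a b * Poly_Mapping.lookup c b)" if "Poly_Mapping.keys c \<subseteq> ?S" for c :: "'b \<Rightarrow>\<^sub>0 int"
    using that by (intro sum.mono_neutral_left) (auto simp: in_keys_iff)
  have "cube_hom B' j f (k \<otimes>\<^bsub>F\<^esub> l) = cube_hom B' j f k + cube_hom B' j f l"
    using kl S[of "coord k"] S[of "coord l"] S[of "coord k + coord l"] keys_add[of "coord k" "coord l"]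
    by (simp add: cube_hom_def coord_mult Poly_Mapping.lookup_add distrib_left sum.distrib)
  then show "cube_hom B' j f (k \<otimes>\<^bsub>F\<lparr>carrier := K\<rparr>\<^esub> l) =
      cube_hom B' j f k \<otimes>\<^bsub>integer_group\<^esub> cube_hom B' j f l" by simp
qed simp

lemma cube_hom_basis:
  "b \<in> B \<Longrightarrow> cube_hom B' j f b = (if b \<in> B' then int (f (j b)) else 0)"
  using B_subset basis_coords_basis[OF K_group B, of b] by (auto simp: cube_hom_def)

lemma continuous_map_cube_hom:
  assumes "j ` B' \<subseteq> Field \<kappa>"
  shows "continuous_map (cantor_cube \<kappa>) (int_dual (F\<lparr>carrier := K\<rparr>)) (cube_hom B' j)"
proof (rule continuous_map_into_int_dual)
  fix f show "cube_hom B' j f \<in> hom (F\<lparr>carrier := K\<rparr>) integer_group \<inter>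
      extensional (carrier (F\<lparr>carrier := K\<rparr>))"
    using cube_hom_hom by (simp add: cube_hom_def)
next
  fix k assume "k \<in> carrier (F\<lparr>carrier := K\<rparr>)"
  then have k: "k \<in> K" by simp
  have "continuous_map (cantor_cube \<kappa>) (discrete_topology UNIV)
      (\<lambda>f. (if b \<in> B' then int (f (j b)) else 0) * Poly_Mapping.lookup (coord k) b)" for b
  proof (cases "b \<in> B'")
    case True
    then have "continuous_map (cantor_cube \<kappa>) (discrete_topology {0, 1}) (\<lambda>f. f (j b))"
      unfolding cantor_cube_def using assms by (intro continuous_map_product_projection) auto
    then have "continuous_map (cantor_cube \<kappa>) (discrete_topology UNIV)
        ((\<lambda>n. int n * Poly_Mapping.lookup (coord k) b) \<circ> (\<lambda>f. f (j b)))"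
      by (rule continuous_map_compose) simp
    then show ?thesis using True by (simp add: o_def)
  qed simp
  then show "continuous_map (cantor_cube \<kappa>) (discrete_topology UNIV) (\<lambda>f. cube_hom B' j f k)"
    unfolding cube_hom_def using k by (simp add: continuous_map_discrete_sum)
qed

lemma coordinate_extensions_of_lift:
  assumes j: "inj_on j B'" "j ` B' \<subseteq> Field \<kappa>"
    and lift: "has_continuous_lift F K \<kappa> (cube_hom B' j)"
  obtains g where "\<And>b. b \<in> B' \<Longrightarrow> g b \<in> hom F integer_group"
    and "\<And>b k. b \<in> B' \<Longrightarrow> k \<in> K \<Longrightarrow> g b k = Poly_Mapping.lookup (coord k) b"
    and "\<And>x. x \<in> carrier F \<Longrightarrow> finite {b \<in> B'. g b x \<noteq> 0}"
proof -
  obtain \<psi> where \<psi>: "continuous_map (cantor_cube \<kappa>) (int_dual F) \<psi>"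
    "\<And>f. f \<in> topspace (cantor_cube \<kappa>) \<Longrightarrow> restrict (\<psi> f) K = cube_hom B' j f"
    using lift by (auto simp: has_continuous_lift_def)
  define z where "z = (\<lambda>i\<in>Field \<kappa>. 0::nat)"
  define \<chi> where "\<chi> i' = (\<lambda>i\<in>Field \<kappa>. if i = i' then 1 else 0::nat)" for i'
  define g where "g b x = \<psi> (\<chi> (j b)) x - \<psi> z x" for b x
  have top: "z \<in> topspace (cantor_cube \<kappa>)" "\<chi> i \<in> topspace (cantor_cube \<kappa>)" for i
    by (auto simp: z_def \<chi>_def topspace_cantor_cube)
  have hom: "\<psi> f \<in> hom F integer_group" if "f \<in> topspace (cantor_cube \<kappa>)" for f
    using continuous_map_funspace[OF \<psi>(1)] that by (auto simp: topspace_int_dual)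
  have on_K: "\<psi> f k = cube_hom B' j f k" if "f \<in> topspace (cantor_cube \<kappa>)" "k \<in> K" for f k
    using fun_cong[OF \<psi>(2)[OF that(1)], of k] that by simp
  show thesis
  proof
    fix b assume "b \<in> B'"
    show "g b \<in> hom F integer_group"
      using hom[OF top(1)] hom[OF top(2)] by (auto simp: hom_def g_def)
  next
    fix b k assume b: "b \<in> B'" and k: "k \<in> K"
    have "(if b' \<in> B' then int (\<chi> (j b) (j b')) else 0) = (if b' = b then 1 else 0)" for b'
      using j b by (auto simp: \<chi>_def inj_on_def)
    then have "cube_hom B' j (\<chi> (j b)) k = Poly_Mapping.lookup (coord k) b"
      using k by (simp add: cube_hom_def in_keys_iff if_distrib[of "\<lambda>u. u * _"] cong: if_cong)
    moreover have "cube_hom B' j z k = 0"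
      using k j by (auto simp: cube_hom_def z_def image_subset_iff intro!: sum.neutral)
    ultimately show "g b k = Poly_Mapping.lookup (coord k) b"
      using on_K top k by (simp add: g_def)
  next
    fix x assume "x \<in> carrier F"
    then have "finite {i \<in> Field \<kappa>. \<psi> (\<chi> i) x \<noteq> \<psi> z x}"
      using finite_changes_at_zero[OF continuous_map_int_dual_eval[OF \<psi>(1)]]
      by (simp add: z_def \<chi>_def)
    then have "finite {b \<in> B'. j b \<in> {i \<in> Field \<kappa>. \<psi> (\<chi> i) x \<noteq> \<psi> z x}}"
      by (rule back_subst[of finite, OF finite_vimage_IntI[OF _ j(1)]]) auto
    then show "finite {b \<in> B'. g b x \<noteq> 0}"
      by (rule rev_finite_subset) (use j in \<open>auto simp: g_def\<close>)
  qed
qed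

lemma ex_map_without_continuous_lift:
  assumes \<kappa>: "Card_order \<kappa>" and H: "subgroup H A" "\<not> free_abelian (A\<lparr>carrier := H\<rparr>)"
    and card: "|H| =o \<kappa>"
  shows "\<exists>\<phi>. continuous_map (cantor_cube \<kappa>) (int_dual (F\<lparr>carrier := K\<rparr>)) \<phi> \<and>
    \<not> has_continuous_lift F K \<kappa> \<phi> \<and>
    (\<forall>f \<in> topspace (cantor_cube \<kappa>). \<forall>t \<in> B. \<phi> f t \<in> {0, 1})"
proof -
  have "H \<subseteq> p ` carrier F"
    using p subgroup.subset[OF H(1)] by (simp add: epi_def)
  then have "\<forall>h\<in>H. \<exists>x\<in>carrier F. p x = h" by blast
  then obtain s where s: "\<And>h. h \<in> H \<Longrightarrow> s h \<in> carrier F" "\<And>h. h \<in> H \<Longrightarrow> p (s h) = h"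
    by metis
  define N where "N = (\<lambda>(h, h'). Poly_Mapping.keys
    (coord (s h \<otimes>\<^bsub>F\<^esub> s h' \<otimes>\<^bsub>F\<^esub> inv\<^bsub>F\<^esub> s (h \<otimes>\<^bsub>A\<^esub> h'))))"
  define B' where "B' = \<Union> (N ` (H \<times> H))"
  have H_A: "h \<in> carrier A" if "h \<in> H" for h using H(1) that by (rule subgroup.mem_carrier)
  have "N (h, h') \<subseteq> B" if "h \<in> H" "h' \<in> H" for h h'
  proof -
    have "h \<otimes>\<^bsub>A\<^esub> h' \<in> H" using H(1) that by (rule subgroup.m_closed)
    then have "s h \<otimes>\<^bsub>F\<^esub> s h' \<otimes>\<^bsub>F\<^esub> inv\<^bsub>F\<^esub> s (h \<otimes>\<^bsub>A\<^esub> h') \<in> K"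
      using that s H_A by (simp add: mem_K_iff)
    then show ?thesis using keys_basis_coords[OF K_group B] by (simp add: N_def)
  qed
  then have B': "B' \<subseteq> B" by (auto simp: B'_def)
  have cocycle: "Poly_Mapping.keys
      (coord (s h \<otimes>\<^bsub>F\<^esub> s h' \<otimes>\<^bsub>F\<^esub> inv\<^bsub>F\<^esub> s (h \<otimes>\<^bsub>A\<^esub> h'))) \<subseteq> B'" if "h \<in> H" "h' \<in> H" for h h'
    using that unfolding B'_def N_def by fastforce
  have no_coordinate_extensions: False
    if "\<And>b. b \<in> B' \<Longrightarrow> g b \<in> hom F integer_group"
      "\<And>b k. b \<in> B' \<Longrightarrow> k \<in> K \<Longrightarrow> g b k = Poly_Mapping.lookup (coord k) b"
      "\<And>x. x \<in> carrier F \<Longrightarrow> finite {b \<in> B'. g b x \<noteq> 0}" for g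
  proof -
    have "free_abelian (A\<lparr>carrier := H\<rparr>)"
      by (rule free_abelian_if_splits[of H s B' g]) (fact H(1) s B' cocycle that)+
    then show False using H(2) by contradiction
  qed
  show ?thesis
  proof (cases "finite H")
    case False
    have "|B'| \<le>o |H|"
      unfolding B'_def
    proof (rule card_of_UNION_ordLeq_infinite[OF False])
      show "|H \<times> H| \<le>o |H|"
        using card_of_Times_same_infinite[OF False] by (rule ordIso_imp_ordLeq)
      show "\<forall>i\<in>H \<times> H. |N i| \<le>o |H|"
        using False by (auto simp: N_def intro!: ordLess_imp_ordLeq finite_ordLess_infinite2)
    qed
    also have "|H| =o |Field \<kappa>|"
      using card card_of_Field_ordIso[OF \<kappa>] ordIso_symmetric ordIso_transitive by blast
    finally obtain j where j: "inj_on j B'" "j ` B' \<subseteq> Field \<kappa>"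
      by (auto simp: card_of_ordLeq[symmetric])
    have "\<not> has_continuous_lift F K \<kappa> (cube_hom B' j)"
    proof
      assume "has_continuous_lift F K \<kappa> (cube_hom B' j)"
      then show False
        by (rule coordinate_extensions_of_lift[OF j]) (rule no_coordinate_extensions)
    qed
    moreover have "cube_hom B' j f t \<in> {0, 1}"
      if "f \<in> topspace (cantor_cube \<kappa>)" "t \<in> B" for f t
    proof (cases "t \<in> B'")
      case True
      then have "f (j t) \<in> {0, 1}" using that j by (auto simp: topspace_cantor_cube dest!: PiE_mem)
      then show ?thesis using True that by (auto simp: cube_hom_basis)
    qed (use that in \<open>simp add: cube_hom_basis\<close>)
    ultimately show ?thesis using continuous_map_cube_hom[OF j(2)] by blast
  next
    case True
    then have finB': "finite B'" by (auto simp: B'_def N_def)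
    define e where "e b = (\<lambda>k\<in>K. Poly_Mapping.lookup (coord k) b)" for b
    have "\<exists>b\<in>B'. \<not> has_continuous_lift F K \<kappa> (\<lambda>_. e b)"
    proof (rule ccontr)
      assume "\<not> ?thesis"
      then obtain \<psi> where \<psi>: "\<And>b. b \<in> B' \<Longrightarrow> continuous_map (cantor_cube \<kappa>) (int_dual F) (\<psi> b)"
        "\<And>b f. b \<in> B' \<Longrightarrow> f \<in> topspace (cantor_cube \<kappa>) \<Longrightarrow> restrict (\<psi> b f) K = e b"
        unfolding has_continuous_lift_def by metis
      define z where "z = (\<lambda>i\<in>Field \<kappa>. 0::nat)"
      have z: "z \<in> topspace (cantor_cube \<kappa>)" by (auto simp: z_def topspace_cantor_cube)
      show False
      proof (rule no_coordinate_extensions)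
        fix b assume "b \<in> B'"
        then show "\<psi> b z \<in> hom F integer_group"
          using continuous_map_funspace[OF \<psi>(1)] z by (auto simp: topspace_int_dual)
      next
        fix b k assume "b \<in> B'" "k \<in> K"
        then show "\<psi> b z k = Poly_Mapping.lookup (coord k) b"
          using fun_cong[OF \<psi>(2)[OF _ z], of b k] by (simp add: e_def)
      qed (use finB' in auto)
    qed
    then obtain b where b: "b \<in> B'" "\<not> has_continuous_lift F K \<kappa> (\<lambda>_. e b)" by blast
    have "e b \<in> hom (F\<lparr>carrier := K\<rparr>) integer_group"
      by (rule homI) (use subgroup.m_closed[OF K] in \<open>auto simp: e_def coord_mult Poly_Mapping.lookup_add\<close>)
    then have "continuous_map (cantor_cube \<kappa>) (int_dual (F\<lparr>carrier := K\<rparr>)) (\<lambda>_. e b)"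
      by (simp add: topspace_int_dual e_def)
    moreover have "e b t \<in> {0, 1}" if "t \<in> B" for t
      using that B_subset basis_coords_basis[OF K_group B that] by (auto simp: e_def lookup_frag_of)
    ultimately show ?thesis using b(2) by blast
  qed
qed

end

theorem theorem5p1:
  fixes A :: "('a, 'm) monoid_scheme" and F :: "('b, 'n) monoid_scheme"
    and K :: "'b set" and p :: "'b \<Rightarrow> 'a" and \<kappa> :: "'k rel"
  assumes "comm_group A" and "\<not> free_abelian A"
    and "min_nonfree_card A \<kappa>"
    and "free_abelian F"
    and "subgroup K F" and "free_abelian (F\<lparr>carrier := K\<rparr>)"
    and "p \<in> epi F A" and "kernel F A p = K"
  shows "(\<exists>\<phi>. continuous_map (cantor_cube \<kappa>) (int_dual (F\<lparr>carrier := K\<rparr>)) \<phi> \<and>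
              \<not> has_continuous_lift F K \<kappa> \<phi>) \<and>
         (\<forall>B. abelian_basis (F\<lparr>carrier := K\<rparr>) B \<longrightarrow>
            (\<exists>\<phi>. continuous_map (cantor_cube \<kappa>) (int_dual (F\<lparr>carrier := K\<rparr>)) \<phi> \<and>
                 \<not> has_continuous_lift F K \<kappa> \<phi> \<and>
                 (\<forall>f \<in> topspace (cantor_cube \<kappa>). \<forall>t \<in> B. \<phi> f t \<in> {0, 1})))"
proof -
  obtain H where H: "subgroup H A" "\<not> free_abelian (A\<lparr>carrier := H\<rparr>)" "|H| =o \<kappa>" and \<kappa>: "Card_order \<kappa>"
    using assms(3) unfolding min_nonfree_card_def nonfree_subgroup_def by blast
  have *: "\<exists>\<phi>. continuous_map (cantor_cube \<kappa>) (int_dual (F\<lparr>carrier := K\<rparr>)) \<phi> \<and>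
      \<not> has_continuous_lift F K \<kappa> \<phi> \<and>
      (\<forall>f \<in> topspace (cantor_cube \<kappa>). \<forall>t \<in> B. \<phi> f t \<in> {0, 1})"
    if "abelian_basis (F\<lparr>carrier := K\<rparr>) B" for B
  proof -
    interpret free_presentation A F K p B
      by (intro free_presentation.intro assms that)
    show ?thesis using \<kappa> H by (rule ex_map_without_continuous_lift)
  qed
  moreover obtain B where "abelian_basis (F\<lparr>carrier := K\<rparr>) B"
    using assms(6) by (auto simp: free_abelian_def)
  ultimately show ?thesis by blast
qed

end
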